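(* The logic ${\cal R}ing(0,+,* )$ is strictly weaker than the logic ${\cal R}ing(0,+,*,<)$: every sentence of ${\cal R}ing(0,+,* )$ is a sentence of ${\cal R}ing(0,+,*,<)$, and there exists a sentence $\theta$ of ${\cal R}ing(0,+,*,<)$ such that no sentence $\sigma$ of ${\cal R}ing(0,+,* )$ satisfies $\mathbb{Z}_m\models\sigma\iff\mathbb{Z}_m\models\theta$ for all integers $m\ge 1$.
   Context: For an integer $m\ge1$, $\mathbb{Z}_m$ is the finite residue class ring with universe $\{0,\ldots,m-1\}$ and addition and multiplication mod $m$. ${\cal R}ing(0,+,* )$ is the set of first-order formulas over a constant symbol $0$ and binary function symbols $+,*$, interpreted in $\mathbb{Z}_m$ as the residue class $0$ and addition and multiplication mod $m$. ${\cal R}ing(0,+,*,<)$ additionally has a binary relation symbol $<$ interpreted in $\mathbb{Z}_m$ as the natural order $0<1<\cdots<m-1$ of the representatives. *)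

theory Defs
  imports "HOL-Number_Theory.Residues"
begin

datatype ring_term =
    Var nat
  | Zero
  | Plus ring_term ring_term
  | Times ring_term ring_term

text \<open>The other connectives and the universal quantifier are the usual abbreviations.\<close>

datatype ring_formula =
    Eq ring_term ring_term
  | Less ring_term ring_term
  | Neg ring_formula
  | Conj ring_formula ring_formula
  | Exists nat ring_formula

datatype ring_symbol = Zero_symb | Plus_symb | Times_symb | Less_symb

primrec term_symbols :: "ring_term \<Rightarrow> ring_symbol set" where
  "term_symbols (Var x) = {}"
| "term_symbols Zero = {Zero_symb}"
| "term_symbols (Plus s t) = {Plus_symb} \<union> term_symbols s \<union> term_symbols t"
| "term_symbols (Times s t) = {Times_symb} \<union> term_symbols s \<union> term_symbols t"

primrec symbols :: "ring_formula \<Rightarrow> ring_symbol set" where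
  "symbols (Eq s t) = term_symbols s \<union> term_symbols t"
| "symbols (Less s t) = {Less_symb} \<union> term_symbols s \<union> term_symbols t"
| "symbols (Neg \<phi>) = symbols \<phi>"
| "symbols (Conj \<phi> \<psi>) = symbols \<phi> \<union> symbols \<psi>"
| "symbols (Exists x \<phi>) = symbols \<phi>"

text \<open>
  Equality is a logical symbol, available in both logics.
\<close>

definition Ring_logic :: "ring_formula set" where
  "Ring_logic = {\<phi>. symbols \<phi> \<subseteq> {Zero_symb, Plus_symb, Times_symb}}"

definition Ring_less_logic :: "ring_formula set" where
  "Ring_less_logic = {\<phi>. symbols \<phi> \<subseteq> {Zero_symb, Plus_symb, Times_symb, Less_symb}}"

primrec term_vars :: "ring_term \<Rightarrow> nat set" where
  "term_vars (Var x) = {x}"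
| "term_vars Zero = {}"
| "term_vars (Plus s t) = term_vars s \<union> term_vars t"
| "term_vars (Times s t) = term_vars s \<union> term_vars t"

primrec free_vars :: "ring_formula \<Rightarrow> nat set" where
  "free_vars (Eq s t) = term_vars s \<union> term_vars t"
| "free_vars (Less s t) = term_vars s \<union> term_vars t"
| "free_vars (Neg \<phi>) = free_vars \<phi>"
| "free_vars (Conj \<phi> \<psi>) = free_vars \<phi> \<union> free_vars \<psi>"
| "free_vars (Exists x \<phi>) = free_vars \<phi> - {x}"

definition sentences :: "ring_formula set \<Rightarrow> ring_formula set" where
  "sentences L = {\<phi> \<in> L. free_vars \<phi> = {}}"

text \<open>
  The library ring \<open>residue_ring m\<close> has carrier \<open>{0..m - 1}\<close> (as integers) and operations
  mod \<open>m\<close>, so the order of the representatives is the order of the integers.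
\<close>

primrec term_val :: "int \<Rightarrow> (nat \<Rightarrow> int) \<Rightarrow> ring_term \<Rightarrow> int" where
  "term_val m e (Var x) = e x"
| "term_val m e Zero = \<zero>\<^bsub>residue_ring m\<^esub>"
| "term_val m e (Plus s t) = term_val m e s \<oplus>\<^bsub>residue_ring m\<^esub> term_val m e t"
| "term_val m e (Times s t) = term_val m e s \<otimes>\<^bsub>residue_ring m\<^esub> term_val m e t"

primrec sat :: "int \<Rightarrow> (nat \<Rightarrow> int) \<Rightarrow> ring_formula \<Rightarrow> bool" where
  "sat m e (Eq s t) \<longleftrightarrow> term_val m e s = term_val m e t"
| "sat m e (Less s t) \<longleftrightarrow> term_val m e s < term_val m e t"
| "sat m e (Neg \<phi>) \<longleftrightarrow> \<not> sat m e \<phi>"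
| "sat m e (Conj \<phi> \<psi>) \<longleftrightarrow> sat m e \<phi> \<and> sat m e \<psi>"
| "sat m e (Exists x \<phi>) \<longleftrightarrow> (\<exists>a\<in>carrier (residue_ring m). sat m (e(x := a)) \<phi>)"

definition Z_models :: "int \<Rightarrow> ring_formula \<Rightarrow> bool" where
  "Z_models m \<phi> \<longleftrightarrow> (\<forall>e. range e \<subseteq> carrier (residue_ring m) \<longrightarrow> sat m e \<phi>)"

end

theory Submission
  imports Defs "HOL-Library.Nat_Bijection"
begin

text \<open>
  If \<open>a\<close> and \<open>b\<close> are coprime then \<open>\<int>\<^sub>a\<^sub>b\<close> is the product of \<open>\<int>\<^sub>a\<close> and \<open>\<int>\<^sub>b\<close>, so by a
  Feferman--Vaught argument the truth of an order-free sentence in it depends on \<open>a\<close> only through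
  one of finitely many types. Hence among the \<open>a\<^sub>i = 2 ^ 2 ^ i\<close> there are \<open>a\<^sub>i\<close> and \<open>a\<^sub>j\<close>, \<open>i < j\<close>, that
  the sentence does not tell apart in \<open>\<int>\<^sub>a\<^sub>b\<close>, whatever the cofactor \<open>b\<close>.
  For \<open>b\<close> take a prime \<open>p\<close> dividing \<open>a\<^sub>i + 1\<close>, hence also \<open>a\<^sub>j - 1\<close>. With the order one can say that
  \<open>x * x + x = 0\<close> has a nonzero solution \<open>x\<close> below \<open>m / 2\<close> with an even representative. For \<open>m = a * p\<close>
  the only nonzero even solution is \<open>0\<close> mod \<open>a\<close> and \<open>-1\<close> mod \<open>p\<close>; it is \<open>a\<^sub>i\<close> for
  \<open>a = a\<^sub>i\<close> but \<open>a\<^sub>j * (p - 1)\<close> for \<open>a = a\<^sub>j\<close>.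
\<close>

section \<open>Semantics of terms and sentences\<close>

lemma carrier_residue_ring: "carrier (residue_ring m) = {0..m - 1}"
  by (simp add: residue_ring_def)

lemma term_val_simps [simp]:
  "term_val m e Zero = 0"
  "term_val m e (Plus s t) = (term_val m e s + term_val m e t) mod m"
  "term_val m e (Times s t) = (term_val m e s * term_val m e t) mod m"
  by (simp_all add: residue_ring_def)

declare term_val.simps(2-4) [simp del]

lemma term_val_cong:
  "(\<And>x. x \<in> term_vars t \<Longrightarrow> e x = e' x) \<Longrightarrow> term_val m e t = term_val m e' t"
  by (induction t) auto

lemma sat_cong:
  "(\<And>x. x \<in> free_vars \<phi> \<Longrightarrow> e x = e' x) \<Longrightarrow> sat m e \<phi> \<longleftrightarrow> sat m e' \<phi>"
proof (induction \<phi> arbitrary: e e')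
  case (Eq s t)
  then show ?case
    using term_val_cong[of s e e' m] term_val_cong[of t e e' m] by auto
next
  case (Less s t)
  then show ?case
    using term_val_cong[of s e e' m] term_val_cong[of t e e' m] by auto
next
  case (Neg \<phi>)
  have "sat m e \<phi> \<longleftrightarrow> sat m e' \<phi>"
    using Neg.prems by (intro Neg.IH) auto
  then show ?case by simp
next
  case (Conj \<phi> \<psi>)
  have "sat m e \<phi> \<longleftrightarrow> sat m e' \<phi>" "sat m e \<psi> \<longleftrightarrow> sat m e' \<psi>"
    using Conj.prems by (auto intro!: Conj.IH)
  then show ?case by simp
next
  case (Exists x \<phi>)
  have "sat m (e(x := a)) \<phi> \<longleftrightarrow> sat m (e'(x := a)) \<phi>" for a
    using Exists.prems by (intro Exists.IH) auto
  then show ?case by simp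
qed

lemma Z_models_sentence:
  assumes "free_vars \<phi> = {}" and "m \<ge> 1"
  shows "Z_models m \<phi> \<longleftrightarrow> sat m (\<lambda>_. 0) \<phi>"
proof
  assume "Z_models m \<phi>"
  then show "sat m (\<lambda>_. 0) \<phi>"
    using \<open>m \<ge> 1\<close> by (auto simp: Z_models_def carrier_residue_ring)
next
  assume "sat m (\<lambda>_. 0) \<phi>"
  moreover have "sat m e \<phi> \<longleftrightarrow> sat m (\<lambda>_. 0) \<phi>" for e
    using assms(1) by (intro sat_cong) simp
  ultimately show "Z_models m \<phi>"
    by (simp add: Z_models_def)
qed

section \<open>Residue rings and coprime factors\<close>

lemma term_val_mod:
  assumes "d dvd m"
  shows "term_val m e t mod d = term_val d (\<lambda>x. e x mod d) t"
proof (induction t)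
  case (Plus s t)
  have "term_val m e (Plus s t) mod d = (term_val m e s mod d + term_val m e t mod d) mod d"
    using assms by (simp add: mod_mod_cancel mod_add_eq)
  with Plus show ?case by simp
next
  case (Times s t)
  have "term_val m e (Times s t) mod d = (term_val m e s mod d * (term_val m e t mod d)) mod d"
    using assms by (simp add: mod_mod_cancel mod_mult_eq)
  with Times show ?case by simp
qed auto

lemma term_val_range:
  assumes "m \<ge> 1" and "range e \<subseteq> {0..<m}"
  shows "term_val m e t \<in> {0..<m}"
  using assms by (induction t) (auto simp: image_subset_iff)

text \<open>Injectivity in the Chinese remainder theorem; it splits an atomic equation into its two
  components.\<close>

lemma eq_iff_mod_coprime:
  fixes u v a b :: int
  assumes "coprime a b" and "u \<in> {0..<a * b}" and "v \<in> {0..<a * b}"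
  shows "u = v \<longleftrightarrow> u mod a = v mod a \<and> u mod b = v mod b"
proof
  assume "u mod a = v mod a \<and> u mod b = v mod b"
  then have "[u = v] (mod a * b)"
    using assms(1) by (intro coprime_cong_mult) (simp_all add: cong_def)
  then show "u = v"
    using assms by (simp add: cong_def)
qed simp

text \<open>Surjectivity in the Chinese remainder theorem; it glues a quantifier witness from its
  two components.\<close>

lemma residue_pair_obtain:
  fixes u v a b :: int
  assumes "a \<ge> 1" "b \<ge> 1" and "coprime a b" and "u \<in> {0..<a}" and "v \<in> {0..<b}"
  obtains c where "c \<in> {0..<a * b}" and "c mod a = u" and "c mod b = v"
proof -
  obtain c where c: "[c = u] (mod a)" "[c = v] (mod b)"
    using binary_chinese_remainder_int[OF assms(3)] by blast
  have "a * b > 0" using assms by simp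
  then show thesis
    using c assms
    by (intro that[of "c mod (a * b)"]) (auto simp: cong_def mod_mod_cancel)
qed

section \<open>Finitely many types for order-free formulas\<close>

text \<open>
  \<open>T\<close> assigns a type to every residue class ring \<open>\<int>\<^sub>a\<close> with a valuation, and it is fine enough to
  determine \<open>\<phi>\<close> in \<open>\<int>\<^sub>a\<^sub>b\<close> once the \<open>b\<close>-component is given.
\<close>

definition factor_type :: "ring_formula \<Rightarrow> (int \<times> (nat \<Rightarrow> int) \<Rightarrow> nat) \<Rightarrow> bool" where
  "factor_type \<phi> T \<longleftrightarrow> finite (range T) \<and>
     (\<forall>a a' b e e'. a \<ge> 1 \<longrightarrow> a' \<ge> 1 \<longrightarrow> b \<ge> 1 \<longrightarrow> coprime a b \<longrightarrow> coprime a' b \<longrightarrow>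
        range e \<subseteq> {0..<a * b} \<longrightarrow> range e' \<subseteq> {0..<a' * b} \<longrightarrow>
        (\<forall>x. e x mod b = e' x mod b) \<longrightarrow>
        T (a, \<lambda>x. e x mod a) = T (a', \<lambda>x. e' x mod a') \<longrightarrow>
        sat (a * b) e \<phi> \<longrightarrow> sat (a' * b) e' \<phi>)"

lemma factor_typeI:
  assumes "finite (range T)"
    and "\<And>a a' b e e'. \<lbrakk>a \<ge> 1; a' \<ge> 1; b \<ge> 1; coprime a b; coprime a' b;
        range e \<subseteq> {0..<a * b}; range e' \<subseteq> {0..<a' * b}; \<And>x. e x mod b = e' x mod b;
        T (a, \<lambda>x. e x mod a) = T (a', \<lambda>x. e' x mod a'); sat (a * b) e \<phi>\<rbrakk>
      \<Longrightarrow> sat (a' * b) e' \<phi>"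
  shows "factor_type \<phi> T"
  unfolding factor_type_def using assms(1) by (intro conjI allI impI) (blast intro: assms(2))+

lemma factor_typeD:
  assumes "factor_type \<phi> T" "a \<ge> 1" "a' \<ge> 1" "b \<ge> 1" "coprime a b" "coprime a' b"
    "range e \<subseteq> {0..<a * b}" "range e' \<subseteq> {0..<a' * b}" "\<And>x. e x mod b = e' x mod b"
    "T (a, \<lambda>x. e x mod a) = T (a', \<lambda>x. e' x mod a')" "sat (a * b) e \<phi>"
  shows "sat (a' * b) e' \<phi>"
  using assms unfolding factor_type_def by blast

text \<open>One bit is enough: reduction is a ring homomorphism, so the equation holds in the
  product iff it holds in both components, and the two rings agree on the component mod
  \<open>b\<close>.\<close>

lemma factor_type_Eq:
  "factor_type (Eq s t)
     (\<lambda>(a, e). of_bool (term_val a e s = term_val a e t))" (is "factor_type _ ?T")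
proof (rule factor_typeI)
  have "range ?T \<subseteq> range of_bool" by auto
  then show "finite (range ?T)" by (rule finite_subset) simp
next
  fix a a' b :: int and e e' :: "nat \<Rightarrow> int"
  assume a: "a \<ge> 1" "a' \<ge> 1" "b \<ge> 1" "coprime a b" "coprime a' b"
    and e: "range e \<subseteq> {0..<a * b}" "range e' \<subseteq> {0..<a' * b}"
    and b: "\<And>x. e x mod b = e' x mod b"
    and T: "?T (a, \<lambda>x. e x mod a) = ?T (a', \<lambda>x. e' x mod a')"
    and sat: "sat (a * b) e (Eq s t)"
  have ab: "a * b \<ge> 1" "a' * b \<ge> 1"
    using a by (simp_all add: int_one_le_iff_zero_less)
  have "term_val (a * b) e s mod a = term_val (a * b) e t mod a"
    using sat by simp
  then have "term_val a (\<lambda>x. e x mod a) s = term_val a (\<lambda>x. e x mod a) t"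
    by (simp add: term_val_mod)
  then have 1: "term_val (a' * b) e' s mod a' = term_val (a' * b) e' t mod a'"
    using T by (simp add: term_val_mod of_bool_def split: if_splits)
  have "term_val (a * b) e s mod b = term_val (a * b) e t mod b"
    using sat by simp
  then have 2: "term_val (a' * b) e' s mod b = term_val (a' * b) e' t mod b"
    by (simp add: term_val_mod b)
  show "sat (a' * b) e' (Eq s t)"
    using eq_iff_mod_coprime[OF a(5) term_val_range[OF ab(2) e(2)] term_val_range[OF ab(2) e(2)]] 1 2
    by simp
qed

text \<open>The implication in \<open>factor_type\<close> runs one way only, but its hypotheses are
  symmetric in the two rings. Exchanging the rings gives the converse, so the same type
  serves.\<close>

lemma factor_type_Neg:
  assumes "factor_type \<phi> T"
  shows "factor_type (Neg \<phi>) T"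
proof (rule factor_typeI)
  show "finite (range T)" using assms by (simp add: factor_type_def)
next
  fix a a' b :: int and e e' :: "nat \<Rightarrow> int"
  assume a: "a \<ge> 1" "a' \<ge> 1" "b \<ge> 1" "coprime a b" "coprime a' b"
    and e: "range e \<subseteq> {0..<a * b}" "range e' \<subseteq> {0..<a' * b}"
    and b: "\<And>x. e x mod b = e' x mod b"
    and T: "T (a, \<lambda>x. e x mod a) = T (a', \<lambda>x. e' x mod a')"
    and sat: "sat (a * b) e (Neg \<phi>)"
  show "sat (a' * b) e' (Neg \<phi>)"
    using factor_typeD[OF assms a(2,1,3,5,4) e(2,1) b[symmetric] T[symmetric]] sat by auto
qed

text \<open>Types are coded as naturals so that one HOL type serves the whole induction on formulas;
  hence the pairing function.\<close>

lemma factor_type_Conj: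
  assumes "factor_type \<phi> T" and "factor_type \<psi> U"
  shows "factor_type (Conj \<phi> \<psi>) (\<lambda>z. prod_encode (T z, U z))" (is "factor_type _ ?V")
proof (rule factor_typeI)
  have "range ?V \<subseteq> prod_encode ` (range T \<times> range U)" by auto
  moreover have "finite (range T \<times> range U)"
    using assms by (simp add: factor_type_def)
  ultimately show "finite (range ?V)" by (blast intro: finite_subset)
next
  fix a a' b :: int and e e' :: "nat \<Rightarrow> int"
  assume a: "a \<ge> 1" "a' \<ge> 1" "b \<ge> 1" "coprime a b" "coprime a' b"
    and e: "range e \<subseteq> {0..<a * b}" "range e' \<subseteq> {0..<a' * b}"
    and b: "\<And>x. e x mod b = e' x mod b"
    and V: "?V (a, \<lambda>x. e x mod a) = ?V (a', \<lambda>x. e' x mod a')"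
    and sat: "sat (a * b) e (Conj \<phi> \<psi>)"
  have "T (a, \<lambda>x. e x mod a) = T (a', \<lambda>x. e' x mod a')"
    "U (a, \<lambda>x. e x mod a) = U (a', \<lambda>x. e' x mod a')"
    using V by simp_all
  then show "sat (a' * b) e' (Conj \<phi> \<psi>)"
    using factor_typeD[OF assms(1) a e b] factor_typeD[OF assms(2) a e b] sat by simp
qed

text \<open>The new type records which types for \<open>\<phi>\<close> are attained as
  \<open>x\<close> ranges over the factor mod \<open>a\<close>. A witness moves to the other ring by
  keeping its residue mod \<open>b\<close> and choosing a residue mod \<open>a'\<close> that attains
  the same type.\<close>

lemma factor_type_Exists:
  assumes "factor_type \<phi> T"
  shows "factor_type (Exists x \<phi>)
    (\<lambda>(a, e). set_encode ((\<lambda>u. T (a, e(x := u))) ` {0..<a}))" (is "factor_type _ ?S")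
proof (rule factor_typeI)
  have fin: "finite (range T)"
    using assms by (simp add: factor_type_def)
  have "range ?S \<subseteq> set_encode ` Pow (range T)" by auto
  then show "finite (range ?S)"
    using fin by (blast intro: finite_subset)
  fix a a' b :: int and e e' :: "nat \<Rightarrow> int"
  assume a: "a \<ge> 1" "a' \<ge> 1" "b \<ge> 1" "coprime a b" "coprime a' b"
    and e: "range e \<subseteq> {0..<a * b}" "range e' \<subseteq> {0..<a' * b}"
    and b: "\<And>y. e y mod b = e' y mod b"
    and S: "?S (a, \<lambda>y. e y mod a) = ?S (a', \<lambda>y. e' y mod a')"
    and sat: "sat (a * b) e (Exists x \<phi>)"
  \<comment> \<open>\<open>set_encode\<close> is injective on finite sets, and both images of
    intervals are finite.\<close>
  have S': "(\<lambda>u. T (a, (\<lambda>y. e y mod a)(x := u))) ` {0..<a} =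
      (\<lambda>u. T (a', (\<lambda>y. e' y mod a')(x := u))) ` {0..<a'}"
    using S by (simp add: set_encode_eq)
  obtain c where c: "c \<in> {0..<a * b}" and satc: "sat (a * b) (e(x := c)) \<phi>"
    using sat by (auto simp: carrier_residue_ring)
  have upd: "(\<lambda>y. (f(x := k)) y mod d) = (\<lambda>y. f y mod d)(x := k mod d)"
    for f :: "nat \<Rightarrow> int" and k d by auto
  have "c mod a \<in> {0..<a}" using a by simp
  then obtain u where u: "u \<in> {0..<a'}"
    and Tu: "T (a, (\<lambda>y. e y mod a)(x := c mod a)) = T (a', (\<lambda>y. e' y mod a')(x := u))"
    using S' by (metis (no_types, lifting) imageE imageI)
  have "c mod b \<in> {0..<b}" using a by simp
  then obtain c' where c': "c' \<in> {0..<a' * b}" "c' mod a' = u" "c' mod b = c mod b"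
    using residue_pair_obtain[OF a(2,3,5) u] by metis
  have "sat (a' * b) (e'(x := c')) \<phi>"
  proof (rule factor_typeD[OF assms a _ _ _ _ satc])
    show "range (e(x := c)) \<subseteq> {0..<a * b}" "range (e'(x := c')) \<subseteq> {0..<a' * b}"
      using c c'(1) e by (auto simp: image_subset_iff)
    show "(e(x := c)) y mod b = (e'(x := c')) y mod b" for y
      using b c'(3) by simp
    show "T (a, \<lambda>y. (e(x := c)) y mod a) = T (a', \<lambda>y. (e'(x := c')) y mod a')"
      unfolding upd c'(2) by (rule Tu)
  qed
  then show "sat (a' * b) e' (Exists x \<phi>)"
    using c'(1) by (auto simp: carrier_residue_ring)
qed

lemma factor_type_exists: "Less_symb \<notin> symbols \<phi> \<Longrightarrow> \<exists>T. factor_type \<phi> T"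
proof (induction \<phi>)
  case (Eq s t)
  show ?case using factor_type_Eq by blast
next
  case (Neg \<phi>)
  then obtain T where "factor_type \<phi> T" by auto
  then show ?case by (blast intro: factor_type_Neg)
next
  case (Conj \<phi> \<psi>)
  then obtain T U where "factor_type \<phi> T" "factor_type \<psi> U" by auto
  then show ?case by (blast intro: factor_type_Conj)
next
  case (Exists x \<phi>)
  then obtain T where "factor_type \<phi> T" by auto
  then show ?case by (blast intro: factor_type_Exists)
\<comment> \<open>Only \<open>Less\<close> remains, which the assumption excludes.\<close>
qed simp

section \<open>The separating sentence\<close>

text \<open>
  The variable \<open>y\<close> is half of the solution \<open>x\<close>: that \<open>y < y + y\<close> and \<open>x < x + x\<close> in \<open>\<int>\<^sub>m\<close> means that
  these sums do not wrap around.
\<close>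

definition small_even_solution :: ring_formula where
  "small_even_solution =
    (let y = Var 0; x = Plus y y
     in Exists 0 (Conj (Less y x) (Conj (Less x (Plus x x)) (Eq (Plus (Times x x) x) Zero))))"

text \<open>If doubling wraps around, the result is \<open>2 * y - m\<close>, which is below
  \<open>y\<close> because \<open>y < m\<close>.\<close>

lemma double_mod_gt_iff:
  fixes y m :: int
  assumes "0 \<le> y" and "y < m"
  shows "y < (y + y) mod m \<longleftrightarrow> 0 < y \<and> 2 * y < m"
proof (cases "2 * y < m")
  case True
  then show ?thesis using assms by simp
next
  case False
  then have "(y + y) mod m = y + y - m"
    using assms by (intro int_mod_pos_eq[where q = 1]) auto
  then show ?thesis using False assms by simp
qed

lemma sat_small_even_solution:
  assumes "m \<ge> 1"
  shows "sat m e small_even_solution \<longleftrightarrow>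
    (\<exists>x. even x \<and> 0 < x \<and> 2 * x < m \<and> m dvd x * (x + 1))" (is "_ \<longleftrightarrow> ?R")
proof -
  have *: "sat m e small_even_solution \<longleftrightarrow>
      (\<exists>y\<in>{0..m - 1}. y < (y + y) mod m \<and>
        (y + y) mod m < ((y + y) mod m + (y + y) mod m) mod m \<and>
        ((y + y) mod m * ((y + y) mod m) mod m + (y + y) mod m) mod m = 0)"
    by (simp add: small_even_solution_def Let_def carrier_residue_ring)
  have dv: "(x * x mod m + x) mod m = 0 \<longleftrightarrow> m dvd x * (x + 1)" for x
    by (simp add: mod_add_left_eq dvd_eq_mod_eq_0 distrib_left)
  show ?thesis
  proof
    assume "sat m e small_even_solution"
    then obtain y where y: "0 \<le> y" "y < m" "y < (y + y) mod m"
      "(y + y) mod m < ((y + y) mod m + (y + y) mod m) mod m"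
      "((y + y) mod m * ((y + y) mod m) mod m + (y + y) mod m) mod m = 0"
      using * by auto
    have y2: "0 < y" "2 * y < m"
      using y double_mod_gt_iff by blast+
    then have x: "(y + y) mod m = y + y" by simp
    have "y + y < (y + y + (y + y)) mod m"
      using y(4) by (simp only: x)
    then have "2 * (y + y) < m"
      using double_mod_gt_iff[of "y + y" m] y2 by simp
    moreover have "m dvd (y + y) * (y + y + 1)"
      using y(5) unfolding x dv .
    ultimately show ?R
      using y2 by (intro exI[of _ "y + y"]) simp
  next
    assume ?R
    then obtain x where x: "even x" "0 < x" "2 * x < m" "m dvd x * (x + 1)" by blast
    then obtain y where y: "x = y + y" by (metis evenE mult_2)
    have m: "(y + y) mod m = x" using x y by simp
    have "y < (y + y) mod m" "x < (x + x) mod m"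
      using x y by simp_all
    then show "sat m e small_even_solution"
      unfolding * using x y dv by (intro bexI[of _ y]) (simp_all only: m, auto)
  qed
qed

text \<open>The witness is \<open>2 ^ k\<close> itself, whose successor is divisible by
  \<open>p\<close>.\<close>

lemma small_even_solution_power2:
  fixes p :: int
  assumes "k \<ge> 1" and "odd p" and "p > 1" and "p dvd 2 ^ k + 1"
  shows "sat (2 ^ k * p) e small_even_solution"
proof -
  have "(1::int) \<le> 2 ^ k * p"
    using assms by (simp add: int_one_le_iff_zero_less)
  \<comment> \<open>This gives \<open>2 * 2 ^ k < 2 ^ k * p\<close>.\<close>
  moreover have "p \<ge> 3" using assms(2,3) by presburger
  ultimately show ?thesis
    using assms unfolding sat_small_even_solution[OF \<open>1 \<le> 2 ^ k * p\<close>]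
    by (intro exI[of _ "2 ^ k"]) auto
qed

text \<open>As \<open>x + 1\<close> is odd, all of \<open>2 ^ k\<close> divides
  \<open>x = 2 ^ k * t\<close>, and \<open>x\<close> is congruent to \<open>t\<close> mod
  \<open>p\<close>. Since \<open>0 < 2 * t < p\<close>, the prime \<open>p\<close> divides neither
  \<open>t\<close> nor \<open>t + 1\<close>.\<close>

lemma not_small_even_solution_power2:
  fixes p :: int
  assumes "prime p" and "odd p" and "p dvd 2 ^ k - 1"
  shows "\<not> sat (2 ^ k * p) e small_even_solution"
proof
  have p: "p > 1" using assms(1) by (simp add: prime_gt_1_int)
  then have m: "(1::int) \<le> 2 ^ k * p"
    by (simp add: int_one_le_iff_zero_less)
  assume "sat (2 ^ k * p) e small_even_solution"
  then obtain x where x: "even x" "0 < x" "2 * x < 2 ^ k * p" "2 ^ k * p dvd x * (x + 1)"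
    unfolding sat_small_even_solution[OF m] by blast
  have "coprime (2 ^ k) (x + 1)" using x(1) by simp
  moreover have "2 ^ k dvd x * (x + 1)" using x(4) by (rule dvd_mult_left)
  ultimately have "2 ^ k dvd x" by (simp add: coprime_dvd_mult_left_iff)
  then obtain t where t: "x = 2 ^ k * t" by (elim dvdE)
  have tpos: "t > 0" using x(2) t by (simp add: zero_less_mult_iff)
  have tp: "2 * t < p"
  proof -
    have "2 ^ k * (2 * t) < 2 ^ k * p" using x(3) t by simp
    then show ?thesis by (simp only: mult_less_cancel_left_pos zero_less_power zero_less_numeral)
  qed
  \<comment> \<open>Here \<open>x - t = (2 ^ k - 1) * t\<close>.\<close>
  have xt: "p dvd x - t"
    using dvd_mult2[OF assms(3), of t] t by (simp add: algebra_simps)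
  have "p dvd x * (x + 1)" using x(4) by (rule dvd_mult_right)
  then consider "p dvd x" | "p dvd x + 1"
    using assms(1) prime_dvd_mult_iff by blast
  then show False
  proof cases
    case 1
    then have "p dvd t" using xt by (metis dvd_diff_right_iff dvd_diff_commute)
    then show False using tpos tp zdvd_not_zless by fastforce
  next
    case 2
    then have "p dvd (x + 1) - (x - t)" using xt by (rule dvd_diff)
    then have "p dvd t + 1" by (simp add: add.commute)
    then have "p \<le> t + 1" using tpos zdvd_imp_le by fastforce
    then show False using tpos tp p assms(2) by presburger
  qed
qed

section \<open>Inexpressibility by the pigeonhole principle\<close>

theorem theorem5p19:
  "sentences Ring_logic \<subseteq> sentences Ring_less_logic \<and>
   (\<exists>\<theta> \<in> sentences Ring_less_logic.
      \<not> (\<exists>\<sigma> \<in> sentences Ring_logic.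
            \<forall>m::int. m \<ge> 1 \<longrightarrow> (Z_models m \<sigma> \<longleftrightarrow> Z_models m \<theta>)))"
proof (intro conjI bexI[of _ small_even_solution] notI)
  show "sentences Ring_logic \<subseteq> sentences Ring_less_logic"
    by (auto simp: sentences_def Ring_logic_def Ring_less_logic_def)
  show \<theta>: "small_even_solution \<in> sentences Ring_less_logic"
    by (auto simp: sentences_def Ring_less_logic_def small_even_solution_def Let_def)
  assume "\<exists>\<sigma> \<in> sentences Ring_logic.
      \<forall>m::int. m \<ge> 1 \<longrightarrow> (Z_models m \<sigma> \<longleftrightarrow> Z_models m small_even_solution)"
  then obtain \<sigma> where \<sigma>: "\<sigma> \<in> sentences Ring_logic"
    and equiv: "\<And>m::int. m \<ge> 1 \<Longrightarrow> Z_models m \<sigma> \<longleftrightarrow> Z_models m small_even_solution"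
    by blast
  have sat_equiv: "sat m (\<lambda>_. 0) \<sigma> \<longleftrightarrow> sat m (\<lambda>_. 0) small_even_solution" if "m \<ge> 1" for m
    using equiv[OF that] \<sigma> \<theta> that by (simp add: sentences_def Z_models_sentence)
  have "Less_symb \<notin> symbols \<sigma>"
    using \<sigma> by (auto simp: sentences_def Ring_logic_def)
  then obtain T where T: "factor_type \<sigma> T"
    using factor_type_exists by blast
  \<comment> \<open>A sentence may be evaluated at the zero valuation, which stays zero modulo every
    factor.\<close>
  define f where "f i = T (2 ^ 2 ^ i, \<lambda>_. 0)" for i :: nat
  have "finite (range f)"
    using T by (auto simp: factor_type_def f_def intro: finite_subset[of _ "range T"])
  then have "\<not> inj f" using finite_imageD by blast
  then obtain i j where ij: "i < j" "f i = f j"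
    unfolding inj_def by (metis nat_neq_iff)
  have "(2::int) ^ 2 ^ i + 1 > 1" by simp
  then have "(2::int) ^ 2 ^ i + 1 \<noteq> 0" "\<not> is_unit ((2::int) ^ 2 ^ i + 1)"
    by (linarith, simp add: zdvd1_eq)
  then obtain p :: int where p: "prime p" "p dvd 2 ^ 2 ^ i + 1"
    by (rule prime_divisorE)
  have odd: "odd p"
    using dvd_trans[OF _ p(2), of 2] by auto
  \<comment> \<open>Modulo \<open>p\<close>, the number \<open>2 ^ 2 ^ i\<close> is -1, and its even
    power with exponent \<open>2 ^ (j - i)\<close> is 1.\<close>
  have "even ((2::nat) ^ (j - i))" using ij(1) by simp
  then have "[(2 ^ 2 ^ i) ^ 2 ^ (j - i) = (1::int)] (mod p)"
    using cong_pow[of "2 ^ 2 ^ i" "- 1" p "2 ^ (j - i)"] p(2) by (simp add: cong_iff_dvd_diff)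
  moreover have "(2::nat) ^ i * 2 ^ (j - i) = 2 ^ j"
    using ij(1) by (simp flip: power_add)
  ultimately have pj: "p dvd 2 ^ 2 ^ j - 1"
    by (simp add: cong_iff_dvd_diff flip: power_mult)
  have p1: "p \<ge> 1" and p_gt: "p > 1"
    using p(1) prime_gt_1_int[of p] by auto
  have ge1: "(2::int) ^ n \<ge> 1" "(2::int) ^ n * p \<ge> 1" for n
    using p1 by (simp_all add: int_one_le_iff_zero_less)
  have "sat (2 ^ 2 ^ i * p) (\<lambda>_. 0) \<sigma>"
    using sat_equiv[OF ge1(2)] small_even_solution_power2[OF _ odd p_gt p(2)] by simp
  \<comment> \<open>Both powers of 2 are coprime to the odd \<open>p\<close>, so equality of types
    carries truth over with the cofactor \<open>p\<close> fixed.\<close>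
  then have "sat (2 ^ 2 ^ j * p) (\<lambda>_. 0) \<sigma>"
    using ge1(2) odd ij(2) p1
    by (intro factor_typeD[OF T ge1(1) ge1(1) p1, of "2 ^ i" "2 ^ j" "\<lambda>_. 0"])
      (auto simp: f_def less_le_trans[OF zero_less_one])
  then show False
    using sat_equiv[OF ge1(2)] not_small_even_solution_power2[OF p(1) odd pj] by simp
qed

end
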